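(* Let $\mathbb U$ be the universal Urysohn space and let $X$ be a compact metric space. (1) If $X$ is a Rakotch fractal, then $X$ is isometric to the attractor $A_{\mathcal{G}}$ of a function system $\mathcal{G}$ consisting of Rakotch contractions of $\mathbb U$. (2) If $X$ is a Banach fractal, then $X$ is isometric to the attractor $A_{\mathcal{G}}$ of a function system $\mathcal{G}$ consisting of Banach contractions of $\mathbb U$.
   Context: The universal Urysohn space $\mathbb U$ is the (unique up to isometry) separable complete metric space such that every isometric embedding $f:B\to\mathbb U$ of a subspace $B$ of a finite metric space $A$ extends to an isometric embedding $\bar f:A\to\mathbb U$. A function system on a metric space $X$ is a finite family of continuous self-maps of $X$; it induces $\mathcal{F}:\mathbb K(X)\to\mathbb K(X)$, $K\mapsto\bigcup_{f\in\mathcal{F}}f(K)$, on the space $\mathbb K(X)$ of non-empty compact subsets of $X$ with the Hausdorff metric. A compact $A\in\mathbb K(X)$ is the attractor $A_{\mathcal{F}}$ of $\mathcal{F}$ if $\mathcal{F}(A)=A$ and $\mathcal{F}^n(K)\to A$ in $\mathbb K(X)$ for every $K\in\mathbb K(X)$. A map $f:(X,d_X)\to(Y,d_Y)$ is Rakotch contracting if there is $\varphi:[0,\infty)\to[0,\infty)$ with $d_Y(f(x),f(x'))\le\varphi(d_X(x,x'))$ for all $x,x'$ and $\sup_{a<t<\infty}\varphi(t)/t<1$ for every $a>0$; it is a Banach contraction if it is Lipschitz with Lipschitz constant $<1$. A compact metric space $X$ is a Rakotch fractal (resp. Banach fractal) if $X=\bigcup_{f\in\mathcal{F}}f(X)$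 for some function system $\mathcal{F}$ consisting of Rakotch contractions (resp. Banach contractions) of $X$. *)

theory Defs
  imports "HOL-Analysis.Analysis"
begin

definition isometric_embedding ::
  "'a set \<Rightarrow> ('a \<Rightarrow> 'a \<Rightarrow> real) \<Rightarrow> 'b set \<Rightarrow> ('b \<Rightarrow> 'b \<Rightarrow> real) \<Rightarrow> ('a \<Rightarrow> 'b) \<Rightarrow> bool" where
  "isometric_embedding A dA B dB f \<longleftrightarrow>
     f ` A \<subseteq> B \<and> (\<forall>x\<in>A. \<forall>y\<in>A. dB (f x) (f y) = dA x y)"

definition isometric ::
  "'a set \<Rightarrow> ('a \<Rightarrow> 'a \<Rightarrow> real) \<Rightarrow> 'b set \<Rightarrow> ('b \<Rightarrow> 'b \<Rightarrow> real) \<Rightarrow> bool" where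
  "isometric A dA B dB \<longleftrightarrow> (\<exists>f. isometric_embedding A dA B dB f \<and> f ` A = B)"

text \<open>Universal Urysohn space: separable complete metric space with the finite
  extension property. Every finite metric space is isometric to one whose carrier is a
  finite set of natural numbers, so finite metric spaces are taken with carrier in nat.\<close>
definition urysohn_space :: "'b set \<Rightarrow> ('b \<Rightarrow> 'b \<Rightarrow> real) \<Rightarrow> bool" where
  "urysohn_space U dU \<longleftrightarrow>
     Metric_space U dU \<and>
     Metric_space.mcomplete U dU \<and>
     separable_space (Metric_space.mtopology U dU) \<and>
     (\<forall>(A::nat set) dA B f.
        finite A \<and> Metric_space A dA \<and> B \<subseteq> A \<and> isometric_embedding B dA U dU f \<longrightarrow>
        (\<exists>g. isometric_embedding A dA U dU g \<and> (\<forall>x\<in>B. g x = f x)))"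

definition function_system :: "'a set \<Rightarrow> ('a \<Rightarrow> 'a \<Rightarrow> real) \<Rightarrow> ('a \<Rightarrow> 'a) set \<Rightarrow> bool" where
  "function_system X d F \<longleftrightarrow> finite F \<and>
     (\<forall>f\<in>F. continuous_map (Metric_space.mtopology X d) (Metric_space.mtopology X d) f)"

definition fs_image :: "('a \<Rightarrow> 'a) set \<Rightarrow> 'a set \<Rightarrow> 'a set" where
  "fs_image F K = (\<Union>f\<in>F. f ` K)"

definition hausdorff_dist :: "('a \<Rightarrow> 'a \<Rightarrow> real) \<Rightarrow> 'a set \<Rightarrow> 'a set \<Rightarrow> real" where
  "hausdorff_dist d A B =
     max (SUP x\<in>A. INF y\<in>B. d x y) (SUP y\<in>B. INF x\<in>A. d x y)"

definition attractor :: "'a set \<Rightarrow> ('a \<Rightarrow> 'a \<Rightarrow> real) \<Rightarrow> ('a \<Rightarrow> 'a) set \<Rightarrow> 'a set \<Rightarrow> bool" where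
  "attractor X d F A \<longleftrightarrow>
     A \<noteq> {} \<and> compactin (Metric_space.mtopology X d) A \<and>
     fs_image F A = A \<and>
     (\<forall>K. K \<noteq> {} \<and> compactin (Metric_space.mtopology X d) K \<longrightarrow>
          (\<lambda>n. hausdorff_dist d ((fs_image F ^^ n) K) A) \<longlonglongrightarrow> 0)"

definition rakotch_contraction ::
  "'a set \<Rightarrow> ('a \<Rightarrow> 'a \<Rightarrow> real) \<Rightarrow> 'b set \<Rightarrow> ('b \<Rightarrow> 'b \<Rightarrow> real) \<Rightarrow> ('a \<Rightarrow> 'b) \<Rightarrow> bool" where
  "rakotch_contraction X dX Y dY f \<longleftrightarrow>
     f ` X \<subseteq> Y \<and>
     (\<exists>\<phi>::real \<Rightarrow> real.
        (\<forall>t\<ge>0. \<phi> t \<ge> 0) \<and>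
        (\<forall>x\<in>X. \<forall>x'\<in>X. dY (f x) (f x') \<le> \<phi> (dX x x')) \<and>
        (\<forall>a>0. \<exists>c<1. \<forall>t>a. \<phi> t / t \<le> c))"

definition banach_contraction ::
  "'a set \<Rightarrow> ('a \<Rightarrow> 'a \<Rightarrow> real) \<Rightarrow> 'b set \<Rightarrow> ('b \<Rightarrow> 'b \<Rightarrow> real) \<Rightarrow> ('a \<Rightarrow> 'b) \<Rightarrow> bool" where
  "banach_contraction X dX Y dY f \<longleftrightarrow>
     f ` X \<subseteq> Y \<and>
     (\<exists>L<1. \<forall>x\<in>X. \<forall>x'\<in>X. dY (f x) (f x') \<le> L * dX x x')"

definition rakotch_fractal :: "'a set \<Rightarrow> ('a \<Rightarrow> 'a \<Rightarrow> real) \<Rightarrow> bool" where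
  "rakotch_fractal X d \<longleftrightarrow>
     compact_space (Metric_space.mtopology X d) \<and>
     (\<exists>F. function_system X d F \<and> (\<forall>f\<in>F. rakotch_contraction X d X d f) \<and>
          X = fs_image F X)"

definition banach_fractal :: "'a set \<Rightarrow> ('a \<Rightarrow> 'a \<Rightarrow> real) \<Rightarrow> bool" where
  "banach_fractal X d \<longleftrightarrow>
     compact_space (Metric_space.mtopology X d) \<and>
     (\<exists>F. function_system X d F \<and> (\<forall>f\<in>F. banach_contraction X d X d f) \<and>
          X = fs_image F X)"

end

theory Submission
  imports Defs
begin

text \<open>A Rakotch contraction of a compact subset of the Urysohn space is dominated by a monotone
  subadditive modulus \<open>w\<close> with the same Rakotch property. If \<open>f\<close> is defined on a compact set
  \<open>A\<close> and \<open>x\<close> is a new point, subadditivity of \<open>w\<close> makes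
  \<open>h z = (INF a\<in>A. d z (f a) + w (d x a))\<close> a Katetov function on \<open>f ` A\<close>. The Urysohn space
  realizes Katetov functions on compact sets, as limits of realizations on finite nets, and a point
  realizing \<open>h\<close> is an admissible value at \<open>x\<close>. Adding the points of a countable dense set one
  by one and passing to the closure extends \<open>f\<close> to the whole space with the same modulus. It
  remains to embed the fractal isometrically and to observe that an invariant compact set of a
  finite system of Rakotch contractions is its attractor.\<close>

section \<open>Extending maps along countable sets and from dense subsets\<close>

text \<open>Since \<open>P\<close> involves only two points at a time, it survives an increasing
  union of partial maps, so \<open>D\<close> can be added one point per stage. Each stage has domain
  \<open>A\<close> plus finitely many points, and such domains stay totally bounded (or finite) when
  \<open>A\<close> is. \<open>P\<close> will be either equality of distances or a bound by a
  modulus; as it need not be symmetric, \<open>step\<close> provides both orders.\<close>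

lemma countable_pairwise_extension:
  fixes U :: "'b set" and P :: "'a \<Rightarrow> 'a \<Rightarrow> 'b \<Rightarrow> 'b \<Rightarrow> bool"
  assumes "countable D"
    and fU: "f ` A \<subseteq> U"
    and fP: "\<And>x y. x \<in> A \<Longrightarrow> y \<in> A \<Longrightarrow> P x y (f x) (f y)"
    and step: "\<And>B g z. finite B \<Longrightarrow> B \<subseteq> D \<Longrightarrow> z \<in> D \<Longrightarrow> g ` (A \<union> B) \<subseteq> U \<Longrightarrow>
        (\<forall>x\<in>A \<union> B. \<forall>y\<in>A \<union> B. P x y (g x) (g y)) \<Longrightarrow>
        \<exists>w\<in>U. P z z w w \<and> (\<forall>x\<in>A \<union> B. P x z (g x) w \<and> P z x w (g x))"
  obtains G where "G ` (A \<union> D) \<subseteq> U" and "\<And>x. x \<in> A \<Longrightarrow> G x = f x"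
    and "\<And>x y. x \<in> A \<union> D \<Longrightarrow> y \<in> A \<union> D \<Longrightarrow> P x y (G x) (G y)"
proof (cases "D = {}")
  case True
  with fU fP that[of f] show ?thesis by auto
next
  case False
  define u where "u = from_nat_into D"
  have ranu: "range u = D"
    unfolding u_def using False \<open>countable D\<close> by (rule range_from_nat_into)
  define S where "S n = A \<union> u ` {..<n}" for n :: nat
  define good where "good n g \<longleftrightarrow> g ` S n \<subseteq> U \<and> (\<forall>x\<in>A. g x = f x) \<and>
      (\<forall>x\<in>S n. \<forall>y\<in>S n. P x y (g x) (g y))" for n and g :: "'a \<Rightarrow> 'b"
  \<comment> \<open>The enumeration may repeat points or meet \<open>A\<close>; a stage that brings
    no new point keeps \<open>g\<close>.\<close>
  have "\<exists>h. good (Suc n) h \<and> (\<forall>x\<in>S n. h x = g x)" if g: "good n g" for n g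
  proof (cases "u n \<in> S n")
    case True
    then have "S (Suc n) = S n" by (auto simp: S_def lessThan_Suc)
    with g show ?thesis by (intro exI[of _ g]) (auto simp: good_def)
  next
    case False
    obtain w where w: "w \<in> U" "P (u n) (u n) w w"
        "\<forall>x\<in>S n. P x (u n) (g x) w \<and> P (u n) x w (g x)"
      using step[of "u ` {..<n}" "u n" g] g ranu unfolding good_def S_def by blast
    have S: "S (Suc n) = insert (u n) (S n)" by (auto simp: S_def lessThan_Suc)
    have "A \<subseteq> S n" by (simp add: S_def)
    with False have "u n \<notin> A" by auto
    have "good (Suc n) (g(u n := w))"
      unfolding good_def S
    proof (intro conjI ballI)
      show "(g(u n := w)) ` insert (u n) (S n) \<subseteq> U"
        using g w False by (auto simp: good_def)
      show "(g(u n := w)) x = f x" if "x \<in> A" for x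
        using g that \<open>u n \<notin> A\<close> by (auto simp: good_def)
      show "P x y ((g(u n := w)) x) ((g(u n := w)) y)"
        if "x \<in> insert (u n) (S n)" "y \<in> insert (u n) (S n)" for x y
        using g w that by (auto simp: good_def)
    qed
    then show ?thesis using False by (intro exI[of _ "g(u n := w)"]) auto
  qed
  moreover have "\<exists>g. good 0 g"
    using fU fP by (intro exI[of _ f]) (auto simp: good_def S_def)
  ultimately obtain g where g: "\<And>n. good n (g n)" "\<And>n x. x \<in> S n \<Longrightarrow> g (Suc n) x = g n x"
    using dependent_nat_choice[of good "\<lambda>n g h. \<forall>x\<in>S n. h x = g x"] by metis
  have Smono: "S m \<subseteq> S n" if "m \<le> n" for m n
    using that unfolding S_def by auto
  have stable: "g n x = g m x" if "m \<le> n" "x \<in> S m" for m n x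
    using that(1)
  proof (induction n rule: dec_induct)
    case (step k)
    have "x \<in> S k" using Smono[of m k] step that by blast
    with step g(2) show ?case by simp
  qed simp
  \<comment> \<open>Each point keeps the value from the first stage that contains it. By
    \<open>stable\<close> all later stages agree, so two points can be compared at any common
    stage.\<close>
  define G where "G x = g (LEAST n. x \<in> S n) x" for x
  have GS: "G x = g n x" if "x \<in> S n" for n x
    unfolding G_def by (metis LeastI Least_le stable that)
  have ex: "\<exists>n. x \<in> S n \<and> y \<in> S n" if "x \<in> A \<union> D" "y \<in> A \<union> D" for x y
  proof -
    have "\<exists>n. z \<in> S n" if "z \<in> A \<union> D" for z
      using that unfolding ranu[symmetric] S_def by blast
    then obtain m n where "x \<in> S m" "y \<in> S n" using \<open>x \<in> A \<union> D\<close> \<open>y \<in> A \<union> D\<close> by meson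
    then show ?thesis using Smono[of m "max m n"] Smono[of n "max m n"] by auto
  qed
  show ?thesis
  proof
    show "G ` (A \<union> D) \<subseteq> U"
      using ex g(1) GS unfolding good_def by (metis image_subset_iff)
    show "G x = f x" if "x \<in> A" for x
      using GS[of x 0] g(1)[of 0] that by (auto simp: good_def S_def)
    show "P x y (G x) (G y)" if "x \<in> A \<union> D" "y \<in> A \<union> D" for x y
      using ex[OF that] g(1) GS unfolding good_def by metis
  qed
qed

text \<open>The values are limits of \<open>g\<close> along sequences in \<open>S\<close>. The last
  conclusion approximates a distance in \<open>Z\<close> and the corresponding distance in
  \<open>U\<close> by the same pair from \<open>S\<close>; in this form it transfers equalities of
  distances as well as bounds by a modulus.\<close>

lemma nonexpansive_extension_from_dense:
  assumes "Metric_space Z dZ" and "Metric_space U dU" and "Metric_space.mcomplete U dU"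
    and SZ: "S \<subseteq> Z" and dense: "\<And>z e. z \<in> Z \<Longrightarrow> e > 0 \<Longrightarrow> \<exists>s\<in>S. dZ z s < e"
    and gU: "g ` S \<subseteq> U"
    and ne: "\<And>x y. x \<in> S \<Longrightarrow> y \<in> S \<Longrightarrow> dU (g x) (g y) \<le> dZ x y"
  obtains G where "G ` Z \<subseteq> U" and "\<And>s. s \<in> S \<Longrightarrow> G s = g s"
    and "\<And>x y e. x \<in> Z \<Longrightarrow> y \<in> Z \<Longrightarrow> e > 0 \<Longrightarrow> \<exists>s\<in>S. \<exists>t\<in>S.
          \<bar>dZ x y - dZ s t\<bar> < e \<and> \<bar>dU (G x) (G y) - dU (g s) (g t)\<bar> < e"
proof -
  interpret Z: Metric_space Z dZ by fact
  interpret U: Metric_space U dU by fact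
  \<comment> \<open>Comparing the limit with every point of \<open>S\<close> makes the approximating
    sequence disappear: this bound alone gives agreement on \<open>S\<close> (with z = s) and the
    approximation property.\<close>
  have "\<exists>w\<in>U. \<forall>s\<in>S. dU w (g s) \<le> dZ z s" if z: "z \<in> Z" for z
  proof -
    obtain s where s: "\<And>n::nat. s n \<in> S" "\<And>n. dZ z (s n) < inverse (Suc n)"
      using dense[OF z, of "inverse (real (Suc _))"] by (metis inverse_positive_iff_positive of_nat_0_less_iff zero_less_Suc)
    have sZ: "s n \<in> Z" for n using s SZ by auto
    have gsU: "g (s n) \<in> U" for n using s gU by auto
    have small: "\<exists>N. \<forall>n\<ge>N. dZ z (s n) < e" if "e > 0" for e
    proof -
      obtain N where N: "inverse (real (Suc N)) < e" using reals_Archimedean[OF \<open>e > 0\<close>] by auto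
      have "dZ z (s n) < e" if "n \<ge> N" for n
        using s(2)[of n] N that le_imp_inverse_le[of "real (Suc N)" "real (Suc n)"] by linarith
      then show ?thesis by blast
    qed
    have "U.MCauchy (\<lambda>n. g (s n))"
      unfolding U.MCauchy_def
    proof (intro conjI allI impI)
      show "range (\<lambda>n. g (s n)) \<subseteq> U" using gsU by auto
      fix e :: real assume "e > 0"
      then obtain N where N: "\<forall>n\<ge>N. dZ z (s n) < e/2" using small[of "e/2"] by auto
      have "dU (g (s n)) (g (s m)) < e" if "N \<le> n" "N \<le> m" for n m
        using ne[OF s(1) s(1), of n m] Z.triangle''[OF sZ z sZ, of n m] N that
        by (smt (verit) field_sum_of_halves)
      then show "\<exists>N. \<forall>n n'. N \<le> n \<longrightarrow> N \<le> n' \<longrightarrow> dU (g (s n)) (g (s n')) < e" by blast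
    qed
    then obtain w where w: "limitin U.mtopology (\<lambda>n. g (s n)) w sequentially"
      using assms(3) unfolding U.mcomplete_def by blast
    then have wU: "w \<in> U" by (rule U.limitin_mspace)
    have "dU w (g t) \<le> dZ z t" if t: "t \<in> S" for t
    proof (rule field_le_epsilon)
      fix e :: real assume "e > 0"
      obtain N where N: "\<forall>n\<ge>N. dZ z (s n) < e/2" using small[of "e/2"] \<open>e > 0\<close> by auto
      obtain N' where N': "\<forall>n\<ge>N'. dU (g (s n)) w < e/2"
        using w \<open>e > 0\<close> unfolding U.limit_metric_sequentially by (meson half_gt_zero)
      define n where "n = max N N'"
      have "dU w (g t) \<le> dU (g (s n)) w + dU (g (s n)) (g t)"
        using U.triangle'' wU gsU gU t by blast
      also have "\<dots> \<le> e/2 + dZ (s n) t"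
        using N' ne[OF s(1)[of n] t] by (smt (verit) max.cobounded2 n_def)
      also have "\<dots> \<le> e/2 + (dZ z (s n) + dZ z t)"
        using Z.triangle''[of "s n" z t] sZ z t SZ by auto
      also have "\<dots> \<le> dZ z t + e" using N by (smt (verit) max.cobounded1 n_def field_sum_of_halves)
      finally show "dU w (g t) \<le> dZ z t + e" .
    qed
    with wU show ?thesis by blast
  qed
  then obtain G where GU: "\<And>z. z \<in> Z \<Longrightarrow> G z \<in> U"
    and G: "\<And>z s. z \<in> Z \<Longrightarrow> s \<in> S \<Longrightarrow> dU (G z) (g s) \<le> dZ z s"
    by metis
  show ?thesis
  proof
    show "G ` Z \<subseteq> U" using GU by auto
    show "G s = g s" if "s \<in> S" for s
      using G[of s s] GU[of s] gU that SZ by (metis U.nonneg U.zero Z.mdist_zero image_subset_iff order_antisym subsetD)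
    show "\<exists>s\<in>S. \<exists>t\<in>S. \<bar>dZ x y - dZ s t\<bar> < e \<and> \<bar>dU (G x) (G y) - dU (g s) (g t)\<bar> < e"
      if x: "x \<in> Z" and y: "y \<in> Z" and "e > 0" for x y e
    proof -
      obtain s t where st: "s \<in> S" "dZ x s < e/2" "t \<in> S" "dZ y t < e/2"
        using dense[OF x, of "e/2"] dense[OF y, of "e/2"] \<open>e > 0\<close> by auto
      have stZ: "s \<in> Z" "t \<in> Z" "g s \<in> U" "g t \<in> U" using st SZ gU by auto
      have "\<bar>dZ x y - dZ s t\<bar> \<le> dZ x s + dZ y t"
        using Z.triangle[of x s y] Z.triangle[of s t y] Z.triangle[of s x t] Z.triangle[of x y t]
          Z.commute stZ x y by (smt (verit))
      moreover have "\<bar>dU (G x) (G y) - dU (g s) (g t)\<bar> \<le> dU (G x) (g s) + dU (G y) (g t)"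
        using U.triangle[of "G x" "g s" "G y"] U.triangle[of "g s" "g t" "G y"]
          U.triangle[of "g s" "G x" "g t"] U.triangle[of "G x" "G y" "g t"]
          U.commute stZ GU[OF x] GU[OF y] by (smt (verit))
      moreover have "dU (G x) (g s) \<le> dZ x s" "dU (G y) (g t) \<le> dZ y t"
        using G x y st by auto
      ultimately show ?thesis using st by (intro bexI[of _ s] bexI[of _ t]) auto
    qed
  qed
qed

section \<open>Moduli of Rakotch contractions\<close>

text \<open>Subadditivity serves twice: it yields the triangle inequality for Katetov functions
  built from \<open>w\<close>, and, with w t \<le> t, it replaces continuity of \<open>w\<close> in
  limit arguments.\<close>

definition rakotch_modulus :: "(real \<Rightarrow> real) \<Rightarrow> bool" where
  "rakotch_modulus w \<longleftrightarrow> w 0 = 0 \<and> (\<forall>t\<ge>0. 0 \<le> w t) \<and>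
     (\<forall>s t. 0 \<le> s \<longrightarrow> s \<le> t \<longrightarrow> w s \<le> w t) \<and>
     (\<forall>s\<ge>0. \<forall>t\<ge>0. w (s + t) \<le> w s + w t) \<and>
     (\<forall>a>0. \<exists>c<1. \<forall>t>a. w t / t \<le> c)"

lemma rakotch_ratio_le:
  fixes \<phi> :: "real \<Rightarrow> real"
  assumes "\<forall>a>0. \<exists>c<1. \<forall>t>a. \<phi> t / t \<le> c" and "t > 0"
  shows "\<phi> t \<le> t"
proof -
  \<comment> \<open>The bound belonging to a concerns only arguments beyond a, so \<open>t\<close>
    itself is reached from a = t/2.\<close>
  obtain c where "c < 1" "\<forall>s>t/2. \<phi> s / s \<le> c" using assms by (meson half_gt_zero)
  then have "\<phi> t / t \<le> 1" using \<open>t > 0\<close> by (smt (verit) field_sum_of_halves)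
  then show ?thesis using \<open>t > 0\<close> by (simp add: divide_le_eq)
qed

lemma rakotch_modulusD:
  assumes "rakotch_modulus w"
  shows "0 \<le> t \<Longrightarrow> 0 \<le> w t"
    and "0 \<le> s \<Longrightarrow> s \<le> t \<Longrightarrow> w s \<le> w t"
    and "0 \<le> s \<Longrightarrow> 0 \<le> t \<Longrightarrow> w (s + t) \<le> w s + w t"
    and "w 0 = 0"
    and "0 \<le> t \<Longrightarrow> w t \<le> t"
proof -
  show "w t \<le> t" if "0 \<le> t"
    using assms rakotch_ratio_le[of w t] that unfolding rakotch_modulus_def by (cases "t = 0") auto
qed (use assms in \<open>simp_all add: rakotch_modulus_def\<close>)

lemma linear_rakotch_modulus:
  assumes "0 \<le> L" "L < 1"
  shows "rakotch_modulus (\<lambda>t. L * t)"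
  unfolding rakotch_modulus_def
  using assms by (auto simp: mult_left_mono distrib_left intro!: exI[of _ L])

text \<open>The modulus is the infimum over \<open>a > 0\<close> of the affine functions of slope \<open>c a\<close> passing
  through \<open>(a, a)\<close>, where \<open>c a < 1\<close> bounds \<open>\<phi> t / t\<close> for \<open>t > a\<close>. Each of them dominates \<open>\<phi>\<close>,
  and an infimum of affine functions with nonnegative intercepts is subadditive.\<close>
lemma rakotch_contraction_modulus:
  assumes "rakotch_contraction X dX Y dY f" and "Metric_space X dX" and "Metric_space Y dY"
  obtains w where "rakotch_modulus w"
    and "\<And>x y. x \<in> X \<Longrightarrow> y \<in> X \<Longrightarrow> dY (f x) (f y) \<le> w (dX x y)"
proof -
  interpret X: Metric_space X dX by fact
  interpret Y: Metric_space Y dY by fact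
  obtain \<phi> where fY: "f ` X \<subseteq> Y"
    and \<phi>: "\<forall>x\<in>X. \<forall>x'\<in>X. dY (f x) (f x') \<le> \<phi> (dX x x')" "\<forall>a>0. \<exists>c<1. \<forall>t>a. \<phi> t / t \<le> c"
    using assms(1) unfolding rakotch_contraction_def by blast
  then obtain c0 where c0: "\<And>a. a > 0 \<Longrightarrow> c0 a < 1" "\<And>a t. a > 0 \<Longrightarrow> t > a \<Longrightarrow> \<phi> t / t \<le> c0 a"
    by metis
  \<comment> \<open>Truncation at 0 makes the slopes nonnegative and hence the affine functions
    monotone.\<close>
  define c where "c a = max 0 (c0 a)" for a
  have c: "0 \<le> c a" "c a < 1" if "a > 0" for a using c0 that by (auto simp: c_def)
  have \<phi>c: "\<phi> t \<le> c a * t" if "a > 0" "t > a" for a t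
    using c0(2)[OF that] that by (simp add: c_def divide_le_eq) (smt (verit) mult_right_mono)
  define l where "l a t = a * (1 - c a) + c a * t" for a t
  have l0: "0 \<le> l a t" if "a > 0" "t \<ge> 0" for a t
    using c[OF that(1)] that by (simp add: l_def)
  define w where "w t = (INF a\<in>{0<..}. l a t)" for t
  have w_le: "w t \<le> l a t" if "a > 0" "t \<ge> 0" for a t
    unfolding w_def using that l0 by (intro cINF_lower bdd_belowI2[of _ 0]) auto
  have w_ge: "B \<le> w t" if "\<And>a. a > 0 \<Longrightarrow> B \<le> l a t" for B t
    unfolding w_def using that by (intro cINF_greatest) auto
  have "rakotch_modulus w"
    unfolding rakotch_modulus_def
  proof (intro conjI allI impI)
    show "0 \<le> w t" if "0 \<le> t" for t using l0 that by (intro w_ge) auto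
    have "w 0 \<le> 0 + a" if "a > 0" for a
      using w_le[OF that, of 0] mult_nonneg_nonneg[OF less_imp_le[OF that] c(1)[OF that]]
      by (simp add: l_def right_diff_distrib)
    then have "w 0 \<le> 0" by (rule field_le_epsilon)
    moreover have "0 \<le> w 0" using l0 by (intro w_ge) auto
    ultimately show "w 0 = 0" by simp
    show "w s \<le> w t" if "0 \<le> s" "s \<le> t" for s t
    proof (rule w_ge)
      fix a :: real assume a: "a > 0"
      show "w s \<le> l a t"
        using w_le[OF a that(1)] mult_left_mono[OF that(2) c(1)[OF a]] by (simp add: l_def)
    qed
    show "w (s + t) \<le> w s + w t" if st: "0 \<le> s" "0 \<le> t" for s t
    proof -
      \<comment> \<open>The line with the smaller slope is used: if c a \<le> c b, then l a (s + t)
        = l a s + c a * t, and c a * t is at most l b t. The two infima are then taken one after the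
        other.\<close>
      have "w (s + t) \<le> l a s + l b t" if ab: "a > 0" "b > 0" for a b
      proof (cases "c a \<le> c b")
        case True
        then have "l a (s + t) \<le> l a s + l b t"
          using mult_right_mono[OF True st(2)] mult_nonneg_nonneg[of b "1 - c b"] ab(2) c[OF ab(2)]
          unfolding l_def distrib_left by linarith
        then show ?thesis using w_le[OF ab(1), of "s + t"] st by linarith
      next
        case False
        then have "l b (s + t) \<le> l a s + l b t"
          using mult_right_mono[of "c b" "c a" s] st(1) mult_nonneg_nonneg[of a "1 - c a"] ab(1) c[OF ab(1)]
          unfolding l_def distrib_left by linarith
        then show ?thesis using w_le[OF ab(2), of "s + t"] st by linarith
      qed
      then have "w (s + t) - l a s \<le> w t" if "a > 0" for a
        using that by (intro w_ge) (smt (verit))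
      then have "w (s + t) - w t \<le> w s"
        by (intro w_ge) (smt (verit))
      then show ?thesis by simp
    qed
    show "\<exists>k<1. \<forall>t>a. w t / t \<le> k" if "a > 0" for a
    proof (intro exI conjI allI impI)
      \<comment> \<open>For t > a the line of parameter a/2 has intercept at most t/2 * (1 - c
        (a/2)), so w t / t is bounded by the midpoint of c (a/2) and 1.\<close>
      let ?b = "a/2"
      have b: "?b > 0" using that by simp
      show "1 - (1 - c ?b) / 2 < 1" using c[OF b] by simp
      fix t assume "t > a"
      then have "w t \<le> ?b * (1 - c ?b) + c ?b * t" using w_le[OF b, of t] that by (simp add: l_def)
      also have "\<dots> \<le> t/2 * (1 - c ?b) + c ?b * t"
        using c[OF b] \<open>t > a\<close> by (intro add_right_mono mult_right_mono) auto
      also have "\<dots> = (1 - (1 - c ?b) / 2) * t" by (simp add: field_simps)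
      finally show "w t / t \<le> 1 - (1 - c ?b) / 2" using \<open>t > a\<close> that by (simp add: divide_le_eq)
    qed
  qed
  moreover have "dY (f x) (f y) \<le> w (dX x y)" if xy: "x \<in> X" "y \<in> X" for x y
  proof (rule w_ge)
    fix a :: real assume a: "a > 0"
    show "dY (f x) (f y) \<le> l a (dX x y)"
    \<comment> \<open>The ratio condition says nothing about \<open>\<phi> 0\<close>, so coinciding
      points are treated directly.\<close>
    proof (cases "x = y")
      case True
      then show ?thesis using l0[OF a] fY xy by (simp add: image_subset_iff)
    next
      case False
      define t where "t = dX x y"
      have t: "t > 0" using False xy by (simp add: t_def)
      have "\<phi> t \<le> l a t"
      proof (cases "t > a")
        case True
        then show ?thesis using \<phi>c[OF a True] a c[OF a] by (simp add: l_def add_increasing)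
      next
        case False
        have "\<phi> t \<le> t" using \<phi>(2) t by (rule rakotch_ratio_le)
        also have "t = t * (1 - c a) + c a * t" by (simp add: algebra_simps)
        also have "\<dots> \<le> l a t"
          unfolding l_def using False c[OF a] by (intro add_right_mono mult_right_mono) auto
        finally show ?thesis .
      qed
      then show ?thesis using \<phi>(1) xy unfolding t_def by force
    qed
  qed
  ultimately show ?thesis by (rule that)
qed

section \<open>Realizing Katetov functions in the Urysohn space\<close>

locale Urysohn = Metric_space U d for U :: "'b set" and d +
  assumes urysohn: "urysohn_space U d"
begin

text \<open>These are the conditions on the distances from a further point to \<open>K\<close>. The
  case x = y contains nonnegativity, and the value 0 is allowed.\<close>

definition katetov_on :: "'b set \<Rightarrow> ('b \<Rightarrow> real) \<Rightarrow> bool" where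
  "katetov_on K h \<longleftrightarrow> (\<forall>x\<in>K. \<forall>y\<in>K. \<bar>h x - h y\<bar> \<le> d x y \<and> d x y \<le> h x + h y)"

lemma katetov_on_subset: "katetov_on K h \<Longrightarrow> L \<subseteq> K \<Longrightarrow> katetov_on L h"
  unfolding katetov_on_def by blast

lemma katetov_on_nonneg: "katetov_on K h \<Longrightarrow> x \<in> K \<Longrightarrow> 0 \<le> h x"
  unfolding katetov_on_def by (smt (verit) nonneg)

text \<open>Prescribing the distances \<open>h\<close> to a new point gives a finite metric space,
  to which the extension property applies. This needs \<open>h\<close> positive; if \<open>h\<close>
  vanishes at some s, then s itself realizes \<open>h\<close>.\<close>

lemma katetov_realized_finite:
  assumes "finite S" and SU: "S \<subseteq> U" and h: "katetov_on S h"
  shows "\<exists>y\<in>U. \<forall>s\<in>S. d y s = h s"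
proof (cases "\<exists>s\<in>S. h s = 0")
  case True
  then obtain s where s: "s \<in> S" "h s = 0" by blast
  then have "d s t = h t" if "t \<in> S" for t
    using h that unfolding katetov_on_def by (smt (verit))
  with s SU show ?thesis by blast
next
  case False
  then have pos: "h s > 0" if "s \<in> S" for s
    using katetov_on_nonneg[OF h that] that by (metis less_eq_real_def)
  obtain s and n :: nat where s: "S = s ` {i. i < n}" and inj: "inj_on s {i. i < n}"
    using finite_imp_nat_seg_image_inj_on[OF \<open>finite S\<close>] by blast
  \<comment> \<open>The indices below \<open>n\<close> stand for \<open>S\<close> and
    \<open>n\<close> is the new point. The absolute values matter off the carrier, because
    \<open>Metric_space\<close> asks for nonnegativity at all pairs.\<close>
  define e where "e i j = (if i = n then if j = n then 0 else \<bar>h (s j)\<bar>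
      else if j = n then \<bar>h (s i)\<bar> else d (s i) (s j))" for i j
  have sS: "s i \<in> S" if "i < n" for i using s that by auto
  have sU: "s i \<in> U" if "i < n" for i using sS[OF that] SU by auto
  have hp: "\<bar>h (s i)\<bar> = h (s i)" if "i < n" for i using pos[OF sS[OF that]] by simp
  have M: "Metric_space {..n} e"
  proof
    show "0 \<le> e x y" "e x y = e y x" for x y by (auto simp: e_def commute)
    show "(e x y = 0) = (x = y)" if "x \<in> {..n}" "y \<in> {..n}" for x y
      using that pos[OF sS[of x]] pos[OF sS[of y]] sU[of x] sU[of y] inj
      unfolding e_def inj_on_def by auto
    show "e x z \<le> e x y + e y z" if xyz: "x \<in> {..n}" "y \<in> {..n}" "z \<in> {..n}" for x y z
    proof -
      have K: "\<bar>h (s i) - h (s j)\<bar> \<le> d (s i) (s j)" "d (s i) (s j) \<le> h (s i) + h (s j)"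
        if "i < n" "j < n" for i j
        using h sS that unfolding katetov_on_def by blast+
      have T: "d (s x) (s z) \<le> d (s x) (s y) + d (s y) (s z)" if "x < n" "y < n" "z < n"
        using triangle sU that by blast
      consider "x = n" | "z = n" | "x < n" "z < n" using xyz by fastforce
      then show ?thesis
      proof cases
        case 1
        then show ?thesis
          using xyz K[of y z] hp[of y] hp[of z] pos[OF sS[of z]] unfolding e_def by fastforce
      next
        case 2
        then show ?thesis
          using xyz K[of x y] hp[of y] hp[of x] pos[OF sS[of x]] unfolding e_def by fastforce
      next
        case 3
        then show ?thesis
          using xyz K[of x z] T hp[of x] hp[of z] unfolding e_def by fastforce
      qed
    qed
  qed
  have "isometric_embedding {..<n} e U d s"
    using sU unfolding isometric_embedding_def e_def by auto
  then have "\<exists>g. isometric_embedding {..n} e U d g \<and> (\<forall>x\<in>{..<n}. g x = s x)"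
    using urysohn M finite_atMost[of n] lessThan_Suc_atMost[of n]
    unfolding urysohn_space_def by (metis lessThan_subset_iff less_imp_le lessI)
  then obtain g where g: "isometric_embedding {..n} e U d g" "\<forall>x<n. g x = s x" by auto
  have "d (g n) (s i) = h (s i)" if "i < n" for i
    using g hp[OF that] that unfolding isometric_embedding_def e_def by (metis atMost_iff less_imp_le order_refl less_irrefl)
  moreover have "g n \<in> U" using g unfolding isometric_embedding_def by auto
  ultimately show ?thesis unfolding s by blast
qed

text \<open>Points realizing \<open>h\<close> on finite nets of mesh \<open>r n\<close> exist, but
  arbitrary choices need not converge. Each one is therefore chosen near its predecessor by
  prescribing the distance to the predecessor as well; completeness then gives a limit that realizes
  \<open>h\<close> on all of \<open>K\<close>.\<close>

lemma katetov_realized_totally_bounded: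
  assumes K: "mtotally_bounded K" and h: "katetov_on K h"
  shows "\<exists>y\<in>U. \<forall>k\<in>K. d y k = h k"
proof -
  have KU: "K \<subseteq> U" using K by (rule mtotally_bounded_imp_subset)
  define r where "r n = (1/2::real) ^ n" for n
  have r: "r n > 0" "r (Suc n) = r n / 2" for n by (auto simp: r_def)
  have "\<forall>n. \<exists>L. finite L \<and> L \<subseteq> K \<and> K \<subseteq> (\<Union>x\<in>L. mball x (r n))"
    using K r(1) unfolding mtotally_bounded_def by blast
  then obtain N where N: "\<And>n. finite (N n)" "\<And>n. N n \<subseteq> K"
      "\<And>n. K \<subseteq> (\<Union>x\<in>N n. mball x (r n))"
    by metis
  define realizes where "realizes n y \<longleftrightarrow> y \<in> U \<and> (\<forall>k\<in>N n. d y k = h k)" for n y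
  \<comment> \<open>Both \<open>h\<close> and the distance to \<open>y\<close> are 1-Lipschitz on
    \<open>K\<close> and agree at a net point within \<open>r n\<close> of \<open>k\<close>, hence
    the factor 2.\<close>
  have close: "\<bar>h k - d y k\<bar> \<le> 2 * r n" if "realizes n y" "k \<in> K" for n y k
  proof -
    obtain x where x: "x \<in> N n" "d x k < r n" using N(3)[of n] \<open>k \<in> K\<close> by (auto simp: mball_def)
    have "x \<in> K" using x N by auto
    moreover have "d y x = h x" "y \<in> U" using that x by (auto simp: realizes_def)
    moreover have "\<bar>d y x - d x k\<bar> \<le> d y k" "d y k \<le> d y x + d x k"
      using mdist_reverse_triangle[of y x k] triangle[of y x k] calculation \<open>k \<in> K\<close> KU by auto
    ultimately show ?thesis using h x \<open>k \<in> K\<close> unfolding katetov_on_def by (smt (verit))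
  qed
  have ex0: "\<exists>y. realizes n y" for n
    using katetov_realized_finite[OF N(1)] katetov_on_subset[OF h N(2)] N(2) KU
    unfolding realizes_def by blast
  have "\<exists>y'. realizes (Suc n) y' \<and> d y y' \<le> 2 * r n" if y: "realizes n y" for n y
  \<comment> \<open>If \<open>y\<close> is already a net point, its distance to the next realization
    is prescribed as h y, which is small by \<open>close\<close> because d y y = 0.\<close>
  proof (cases "y \<in> N (Suc n)")
    case True
    obtain y' where y': "realizes (Suc n) y'" using ex0 by blast
    have "y \<in> K" "y \<in> U" using True N y by (auto simp: realizes_def)
    have "d y' y = h y" using y' True by (auto simp: realizes_def)
    also have "\<dots> \<le> 2 * r n" using close[OF y \<open>y \<in> K\<close>] \<open>y \<in> U\<close> by simp
    finally show ?thesis using y' commute by metis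
  next
    case False
    \<comment> \<open>\<open>Max T\<close> is the largest discrepancy between \<open>h\<close> and
      the distance to \<open>y\<close> on the next net, the least distance to \<open>y\<close>
      compatible with \<open>h\<close>. Inserting 0 covers an empty net.\<close>
    define T where "T = insert 0 ((\<lambda>k. \<bar>h k - d y k\<bar>) ` N (Suc n))"
    define h' where "h' = h(y := Max T)"
    have yU: "y \<in> U" using y by (simp add: realizes_def)
    have finT: "finite T" and neT: "T \<noteq> {}" using N(1) by (auto simp: T_def)
    have c: "\<bar>h k - d y k\<bar> \<le> Max T" if "k \<in> N (Suc n)" for k
      using that finT by (intro Max_ge) (auto simp: T_def)
    have T0: "0 \<le> Max T" using finT by (intro Max_ge) (auto simp: T_def)
    have T2: "Max T \<le> 2 * r n"
      using close[OF y] N(2) r(1)[of n] finT neT by (subst Max_le_iff) (auto simp: T_def)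
    \<comment> \<open>This is the Katetov condition bounding the value at \<open>y\<close> from
      above; the other two inequalities for a pair containing \<open>y\<close> come from
      \<open>c\<close>.\<close>
    have Tb: "Max T \<le> h b + d y b" if b: "b \<in> N (Suc n)" for b
    proof -
      have "\<bar>h k - d y k\<bar> \<le> h b + d y b" if k: "k \<in> N (Suc n)" for k
      proof -
        have kb: "k \<in> K" "b \<in> K" using k b N(2) by auto
        then have "\<bar>h k - h b\<bar> \<le> d k b" "d k b \<le> h k + h b"
          using h unfolding katetov_on_def by blast+
        moreover have "d y k \<le> d y b + d k b" "d k b \<le> d y k + d y b"
          using triangle'[of y b k] triangle''[of k y b] kb KU yU by auto
        ultimately show ?thesis by linarith
      qed
      moreover have "0 \<le> h b + d y b" using katetov_on_nonneg[OF h, of b] b N(2) by fastforce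
      ultimately show ?thesis using finT neT by (subst Max_le_iff) (auto simp: T_def)
    qed
    have "katetov_on (insert y (N (Suc n))) h'"
      unfolding katetov_on_def
    proof (intro ballI)
      fix a b assume ab: "a \<in> insert y (N (Suc n))" "b \<in> insert y (N (Suc n))"
      have "\<bar>h a - h b\<bar> \<le> d a b \<and> d a b \<le> h a + h b" if "a \<in> N (Suc n)" "b \<in> N (Suc n)"
        using h N(2) that unfolding katetov_on_def by blast
      with ab c[of a] c[of b] Tb[of a] Tb[of b] yU commute[of a y] T0 False
      show "\<bar>h' a - h' b\<bar> \<le> d a b \<and> d a b \<le> h' a + h' b"
        unfolding h'_def by auto
    qed
    then obtain y' where y': "y' \<in> U" "\<forall>s\<in>insert y (N (Suc n)). d y' s = h' s"
      using katetov_realized_finite[of "insert y (N (Suc n))" h'] N KU yU by blast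
    have "realizes (Suc n) y'" using y' False unfolding realizes_def h'_def by auto
    moreover have "d y y' \<le> 2 * r n" using y' commute[of y y'] T2 by (simp add: h'_def)
    ultimately show ?thesis by blast
  qed
  then obtain y where y: "\<And>n. realizes n (y n)" "\<And>n. d (y n) (y (Suc n)) \<le> 2 * r n"
    using dependent_nat_choice[of realizes "\<lambda>n y y'. d y y' \<le> 2 * r n"] ex0 by metis
  have yU: "y n \<in> U" for n using y by (simp add: realizes_def)
  \<comment> \<open>The bound telescopes: 2 * r k = 4 * r k - 4 * r (Suc k).\<close>
  have tail: "d (y m) (y n) \<le> 4 * r m - 4 * r n" if "m \<le> n" for m n
    using that
  proof (induction n rule: dec_induct)
    case base
    then show ?case using yU by simp
  next
    case (step k)
    have "d (y m) (y (Suc k)) \<le> d (y m) (y k) + d (y k) (y (Suc k))" using triangle yU by blast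
    then show ?case using step y(2)[of k] r(2)[of k] by simp
  qed
  have rlim: "r \<longlonglongrightarrow> 0" unfolding r_def by (intro LIMSEQ_power_zero) auto
  have "MCauchy y"
    unfolding MCauchy_def
  proof (intro conjI allI impI)
    show "range y \<subseteq> U" using yU by auto
    fix e :: real assume "e > 0"
    then obtain M where M: "r M < e/8"
      using order_tendstoD(2)[OF rlim, of "e/8"] by (auto simp: eventually_sequentially)
    have "d (y n) (y m) < e" if "M \<le> n" "M \<le> m" for n m
      using triangle''[of "y n" "y M" "y m"] yU tail[OF that(1)] tail[OF that(2)] M r(1)[of n] r(1)[of m]
      by fastforce
    then show "\<exists>N. \<forall>n n'. N \<le> n \<longrightarrow> N \<le> n' \<longrightarrow> d (y n) (y n') < e" by blast
  qed
  then obtain z where z: "limitin mtopology y z sequentially"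
    using urysohn unfolding urysohn_space_def mcomplete_def by blast
  have zU: "z \<in> U" using z by (rule limitin_mspace)
  have zlim: "(\<lambda>n. d (y n) z) \<longlonglongrightarrow> 0" using z by (simp add: limitin_metric_dist_null)
  have "d z k = h k" if k: "k \<in> K" for k
  proof -
    have "\<bar>d z k - h k\<bar> \<le> d (y n) z + 2 * r n" for n
      using close[OF y(1) k, of n] mdist_reverse_triangle[of z k "y n"] triangle[of z "y n" k] k KU zU yU[of n] commute
      by (smt (verit) subsetD)
    moreover have "(\<lambda>n. d (y n) z + 2 * r n) \<longlonglongrightarrow> 0 + 2 * 0"
      by (intro tendsto_intros zlim rlim)
    ultimately have "\<bar>d z k - h k\<bar> \<le> 0 + 2 * 0"
      by (intro LIMSEQ_le_const) auto
    then show ?thesis by simp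
  qed
  with zU show ?thesis by blast
qed


section \<open>Extending contractions with a given modulus\<close>

lemma contractive_one_point_extension:
  assumes w: "rakotch_modulus w" and A: "mtotally_bounded A" "A \<noteq> {}" and fU: "f ` A \<subseteq> U"
    and f: "\<And>x y. x \<in> A \<Longrightarrow> y \<in> A \<Longrightarrow> d (f x) (f y) \<le> w (d x y)"
    and x: "x \<in> U"
  shows "\<exists>y\<in>U. \<forall>a\<in>A. d y (f a) \<le> w (d x a)"
proof -
  note W = rakotch_modulusD[OF w]
  have AU: "A \<subseteq> U" using A(1) by (rule mtotally_bounded_imp_subset)
  have faU: "f a \<in> U" if "a \<in> A" for a using that fU by auto
  define h where "h z = (INF a\<in>A. d z (f a) + w (d x a))" for z
  have bdd: "bdd_below ((\<lambda>a. d z (f a) + w (d x a)) ` A)" for z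
    by (rule bdd_belowI2[of _ 0]) (simp add: W)
  have h_le: "h z \<le> d z (f a) + w (d x a)" if "a \<in> A" for z a
    unfolding h_def by (rule cINF_lower[OF bdd that])
  have h_ge: "B \<le> h z" if "\<And>a. a \<in> A \<Longrightarrow> B \<le> d z (f a) + w (d x a)" for B z
    unfolding h_def using A(2) that by (rule cINF_greatest)
  have h_diff: "h y - d y z \<le> h z" if "y \<in> U" "z \<in> U" for y z
  proof (rule h_ge)
    fix a assume "a \<in> A"
    then show "h y - d y z \<le> d z (f a) + w (d x a)"
      using h_le[of a y] triangle[of y z "f a"] faU that by force
  qed
  have "katetov_on (f ` A) h"
    unfolding katetov_on_def
  proof (intro ballI conjI)
    fix y z assume "y \<in> f ` A" "z \<in> f ` A"
    then have yz: "y \<in> U" "z \<in> U" using fU by auto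
    show "\<bar>h y - h z\<bar> \<le> d y z" using h_diff[OF yz] h_diff[OF yz(2,1)] commute[of y z] by linarith
    \<comment> \<open>The two infima are removed one at a time. What remains is the path y, f a, f
      b, z, whose middle piece is at most w (d a b) \<le> w (d x a + d x b) \<le> w (d x a) + w (d x
      b).\<close>
    have "d y z - h z \<le> h y"
    proof (rule h_ge)
      fix a assume a: "a \<in> A"
      have "d y z - (d y (f a) + w (d x a)) \<le> h z"
      proof (rule h_ge)
        fix b assume b: "b \<in> A"
        have "d a b \<le> d x a + d x b" using triangle'' a b x AU by blast
        then have "d (f a) (f b) \<le> w (d x a + d x b)"
          using f[OF a b] W(2)[of "d a b" "d x a + d x b"] by simp
        also have "\<dots> \<le> w (d x a) + w (d x b)" by (simp add: W)
        finally show "d y z - (d y (f a) + w (d x a)) \<le> d z (f b) + w (d x b)"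
          using triangle[of y "f a" z] triangle'[of "f a" "f b" z] faU[OF a] faU[OF b] yz by linarith
      qed
      then show "d y z - h z \<le> d y (f a) + w (d x a)" by linarith
    qed
    then show "d y z \<le> h y + h z" by linarith
  qed
  \<comment> \<open>As w t \<le> t, the map \<open>f\<close> is nonexpansive and carries nets to
    nets.\<close>
  moreover have "mtotally_bounded (f ` A)"
    unfolding mtotally_bounded_def
  proof (intro allI impI)
    fix e :: real assume "e > 0"
    then obtain L where L: "finite L" "L \<subseteq> A" "A \<subseteq> (\<Union>x\<in>L. mball x e)"
      using A(1) unfolding mtotally_bounded_def by metis
    have "f a \<in> (\<Union>x\<in>f ` L. mball x e)" if a: "a \<in> A" for a
    proof -
      obtain l where l: "l \<in> L" "d l a < e" using L a by (auto simp: mball_def)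
      have lA: "l \<in> A" using l L by auto
      have "d (f l) (f a) < e" using f[OF lA a] W(5)[of "d l a"] l by simp
      then have "f a \<in> mball (f l) e" using faU a lA by simp
      with l show ?thesis by blast
    qed
    then show "\<exists>K. finite K \<and> K \<subseteq> f ` A \<and> f ` A \<subseteq> (\<Union>x\<in>K. mball x e)"
      using L by (intro exI[of _ "f ` L"]) auto
  qed
  ultimately obtain y where y: "y \<in> U" "\<forall>k\<in>f ` A. d y k = h k"
    using katetov_realized_totally_bounded by blast
  have "d y (f a) \<le> w (d x a)" if "a \<in> A" for a
    using y(2) h_le[OF that, of "f a"] faU[OF that] that by simp
  with y show ?thesis by blast
qed

text \<open>Adding finitely many points keeps \<open>A\<close> totally bounded, so the one-point
  extension can be repeated along a countable dense set; nonexpansiveness then gives the values on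
  the rest of \<open>U\<close>.\<close>

lemma contractive_extension:
  assumes w: "rakotch_modulus w" and A: "mtotally_bounded A" "A \<noteq> {}" and fU: "f ` A \<subseteq> U"
    and f: "\<And>x y. x \<in> A \<Longrightarrow> y \<in> A \<Longrightarrow> d (f x) (f y) \<le> w (d x y)"
  obtains g where "g ` U \<subseteq> U" and "\<And>x. x \<in> A \<Longrightarrow> g x = f x"
    and "\<And>x y. x \<in> U \<Longrightarrow> y \<in> U \<Longrightarrow> d (g x) (g y) \<le> w (d x y)"
proof -
  note W = rakotch_modulusD[OF w]
  have AU: "A \<subseteq> U" using A(1) by (rule mtotally_bounded_imp_subset)
  obtain D where D: "countable D" "D \<subseteq> U" "mtopology closure_of D = U"
    using urysohn unfolding urysohn_space_def separable_space_def by auto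
  have step: "\<exists>v\<in>U. d v v \<le> w (d z z) \<and> (\<forall>x\<in>A \<union> B. d (g x) v \<le> w (d x z) \<and> d v (g x) \<le> w (d z x))"
    if B: "finite B" "B \<subseteq> D" "z \<in> D" "g ` (A \<union> B) \<subseteq> U"
      "\<forall>x\<in>A \<union> B. \<forall>y\<in>A \<union> B. d (g x) (g y) \<le> w (d x y)" for B g z
  proof -
    have "mtotally_bounded (A \<union> B)"
      using A(1) finite_imp_mtotally_bounded[of B] B D by (intro mtotally_bounded_Un) auto
    then obtain v where v: "v \<in> U" "\<forall>a\<in>A \<union> B. d v (g a) \<le> w (d z a)"
      using contractive_one_point_extension[OF w, of "A \<union> B" g z] B A(2) D by blast
    with W(1)[of "d z z"] show ?thesis by (intro bexI[of _ v]) (auto simp: commute)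
  qed
  obtain g0 where g0: "g0 ` (A \<union> D) \<subseteq> U" "\<And>x. x \<in> A \<Longrightarrow> g0 x = f x"
    "\<And>x y. x \<in> A \<union> D \<Longrightarrow> y \<in> A \<union> D \<Longrightarrow> d (g0 x) (g0 y) \<le> w (d x y)"
    by (rule countable_pairwise_extension[of D f A U "\<lambda>x y v z. d v z \<le> w (d x y)",
          OF D(1) fU], erule (1) f, erule (4) step) (rule that)
  have dense: "\<exists>s\<in>A \<union> D. d z s < e" if "z \<in> U" "e > 0" for z e
    using that D(3) unfolding metric_closure_of by fastforce
  have ne: "d (g0 x) (g0 y) \<le> d x y" if "x \<in> A \<union> D" "y \<in> A \<union> D" for x y
    using g0(3)[OF that] W(5)[of "d x y"] by simp
  have SU: "A \<union> D \<subseteq> U" using AU D(2) by blast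
  have complete: mcomplete using urysohn unfolding urysohn_space_def by blast
  obtain g where g: "g ` U \<subseteq> U" "\<And>s. s \<in> A \<union> D \<Longrightarrow> g s = g0 s"
    "\<And>x y e. x \<in> U \<Longrightarrow> y \<in> U \<Longrightarrow> e > 0 \<Longrightarrow> \<exists>s\<in>A \<union> D. \<exists>t\<in>A \<union> D.
          \<bar>d x y - d s t\<bar> < e \<and> \<bar>d (g x) (g y) - d (g0 s) (g0 t)\<bar> < e"
    by (rule nonexpansive_extension_from_dense[OF Metric_space_axioms Metric_space_axioms complete
          SU _ g0(1)], erule (1) dense, erule (1) ne) (rule that)
  show ?thesis
  proof
    show "g ` U \<subseteq> U" by fact
    show "g x = f x" if "x \<in> A" for x using that g g0 by auto
    show "d (g x) (g y) \<le> w (d x y)" if xy: "x \<in> U" "y \<in> U" for x y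
    proof (rule field_le_epsilon)
      fix e :: real assume "e > 0"
      then obtain s t where st: "s \<in> A \<union> D" "t \<in> A \<union> D" "\<bar>d x y - d s t\<bar> < e/2"
          "\<bar>d (g x) (g y) - d (g0 s) (g0 t)\<bar> < e/2"
        using g(3)[OF xy, of "e/2"] by auto
      \<comment> \<open>Half of the error arises in the target; the other half arises in the domain
        and costs at most w (e/2) \<le> e/2 by subadditivity.\<close>
      have "d (g x) (g y) \<le> w (d s t) + e/2" using g0(3)[OF st(1,2)] st(4) by linarith
      also have "w (d s t) \<le> w (d x y + e/2)" using st(3) by (intro W(2) nonneg) linarith
      also have "\<dots> \<le> w (d x y) + w (e/2)" using \<open>e > 0\<close> by (intro W(3)) auto
      also have "w (e/2) \<le> e/2" using \<open>e > 0\<close> by (intro W(5)) auto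
      finally show "d (g x) (g y) \<le> w (d x y) + e" by simp
    qed
  qed
qed

section \<open>Isometric embedding of separable spaces\<close>

text \<open>A partial isometry on a finite set extends to one more point because the distances to
  that point form a Katetov function on the image. Starting from the empty map this handles a
  countable dense set, and the equality of distances passes to the closure.\<close>

lemma separable_embeds:
  assumes "Metric_space X dX" and "separable_space (Metric_space.mtopology X dX)"
  obtains e where "isometric_embedding X dX U d e"
proof -
  interpret X: Metric_space X dX by fact
  obtain D where D: "countable D" "D \<subseteq> X" "X.mtopology closure_of D = X"
    using assms(2) unfolding separable_space_def by auto
  have step: "\<exists>v\<in>U. d v v = dX z z \<and> (\<forall>x\<in>{} \<union> B. d (g x) v = dX x z \<and> d v (g x) = dX z x)"
    if B: "finite B" "B \<subseteq> D" and z: "z \<in> D" and gU: "g ` ({} \<union> B) \<subseteq> U"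
      and g: "\<forall>x\<in>{} \<union> B. \<forall>y\<in>{} \<union> B. d (g x) (g y) = dX x y" for B g z
  proof -
    have BX: "x \<in> X" if "x \<in> B" for x using that B D by auto
    have zX: "z \<in> X" using z D by auto
    have inj: "inj_on g B"
      using g BX X.zero by (intro inj_onI) (metis Un_iff)
    \<comment> \<open>The distance to \<open>z\<close>, carried over to the image of
      \<open>B\<close>.\<close>
    define h where "h v = dX z (inv_into B g v)" for v
    have h: "h (g x) = dX z x" if "x \<in> B" for x using inj that by (simp add: h_def)
    have "katetov_on (g ` B) h"
      unfolding katetov_on_def
    proof (clarify, intro conjI)
      fix x y assume xy: "x \<in> B" "y \<in> B"
      show "\<bar>h (g x) - h (g y)\<bar> \<le> d (g x) (g y)"
        using xy X.mdist_reverse_triangle[of x z y] BX zX g X.commute[of x z] by (simp add: h)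
      show "d (g x) (g y) \<le> h (g x) + h (g y)"
        using xy X.triangle''[of x z y] BX zX g by (simp add: h)
    qed
    then obtain v where "v \<in> U" "\<forall>s\<in>g ` B. d v s = h s"
      using katetov_realized_finite[of "g ` B" h] B gU by auto
    then show ?thesis using zX by (intro bexI[of _ v]) (auto simp: h commute X.commute)
  qed
  obtain e0 where e0: "e0 ` D \<subseteq> U" "\<And>x y. x \<in> D \<Longrightarrow> y \<in> D \<Longrightarrow> d (e0 x) (e0 y) = dX x y"
    by (rule countable_pairwise_extension[of D undefined "{}" U "\<lambda>x y v z. d v z = dX x y",
          OF D(1)], simp, simp, erule (4) step) (simp add: that)
  have ne: "d (e0 x) (e0 y) \<le> dX x y" if "x \<in> D" "y \<in> D" for x y
    using e0(2)[OF that] by simp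
  have complete: mcomplete using urysohn unfolding urysohn_space_def by blast
  have dense: "\<exists>s\<in>D. dX z s < e" if "z \<in> X" "e > 0" for z e
    using that D(3) unfolding X.metric_closure_of by fastforce
  obtain e where e: "e ` X \<subseteq> U"
    "\<And>x y \<epsilon>. x \<in> X \<Longrightarrow> y \<in> X \<Longrightarrow> \<epsilon> > 0 \<Longrightarrow> \<exists>s\<in>D. \<exists>t\<in>D.
          \<bar>dX x y - dX s t\<bar> < \<epsilon> \<and> \<bar>d (e x) (e y) - d (e0 s) (e0 t)\<bar> < \<epsilon>"
    by (rule nonexpansive_extension_from_dense[OF assms(1) Metric_space_axioms complete
          D(2) _ e0(1)], erule (1) dense, erule (1) ne) (rule that)
  have "d (e x) (e y) = dX x y" if "x \<in> X" "y \<in> X" for x y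
  proof -
    have "\<bar>d (e x) (e y) - dX x y\<bar> \<le> 0 + \<epsilon>" if "\<epsilon> > 0" for \<epsilon>
    proof -
      obtain s t where "s \<in> D" "t \<in> D" "\<bar>dX x y - dX s t\<bar> < \<epsilon>/2"
          "\<bar>d (e x) (e y) - d (e0 s) (e0 t)\<bar> < \<epsilon>/2"
        using e(2)[OF \<open>x \<in> X\<close> \<open>y \<in> X\<close>, of "\<epsilon>/2"] \<open>\<epsilon> > 0\<close> by auto
      then show ?thesis using e0(2)[of s t] by linarith
    qed
    then have "\<bar>d (e x) (e y) - dX x y\<bar> \<le> 0" by (rule field_le_epsilon)
    then show ?thesis by simp
  qed
  with e(1) that show ?thesis unfolding isometric_embedding_def by blast
qed

end

section \<open>Attractors of finite systems of Rakotch contractions\<close>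

lemma (in Metric_space) rakotch_contraction_imp_continuous:
  assumes "rakotch_contraction M d M d f"
  shows "continuous_map mtopology mtopology f"
proof -
  obtain w where w: "rakotch_modulus w"
    "\<And>x y. x \<in> M \<Longrightarrow> y \<in> M \<Longrightarrow> d (f x) (f y) \<le> w (d x y)"
    using rakotch_contraction_modulus[OF assms Metric_space_axioms Metric_space_axioms] by metis
  have "d (f x) (f y) \<le> d x y" if "x \<in> M" "y \<in> M" for x y
    using w(2)[OF that] rakotch_modulusD(5)[OF w(1), of "d x y"] by simp
  moreover have "f ` M \<subseteq> M" using assms by (simp add: rakotch_contraction_def)
  ultimately show ?thesis
    unfolding metric_continuous_map[OF Metric_space_axioms] by (meson order_le_less_trans)
qed

text \<open>Beyond the scale \<open>e\<close> the ratio bound acts as a Lipschitz constant below 1;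
  up to that scale w t \<le> t \<le> e. Unlike the modulus, this form is easy to iterate.\<close>

lemma (in Metric_space) rakotch_contraction_le_max:
  assumes "rakotch_contraction M d M d f" and "e > 0"
  obtains c where "0 \<le> c" "c < 1"
    and "\<And>x y. x \<in> M \<Longrightarrow> y \<in> M \<Longrightarrow> d (f x) (f y) \<le> max e (c * d x y)"
proof -
  obtain w where w: "rakotch_modulus w"
    "\<And>x y. x \<in> M \<Longrightarrow> y \<in> M \<Longrightarrow> d (f x) (f y) \<le> w (d x y)"
    using rakotch_contraction_modulus[OF assms(1) Metric_space_axioms Metric_space_axioms] by metis
  have "\<forall>a>0. \<exists>c<1. \<forall>t>a. w t / t \<le> c" using w(1) by (simp add: rakotch_modulus_def)
  then obtain c where c: "c < 1" "\<forall>t>e. w t / t \<le> c" using \<open>e > 0\<close> by metis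
  have "w t \<le> max e (max 0 c * t)" if "t \<ge> 0" for t
  proof (cases "t > e")
    case True
    then have "w t \<le> c * t" using c(2) \<open>e > 0\<close> by (simp add: divide_le_eq)
    also have "\<dots> \<le> max 0 c * t" using that by (intro mult_right_mono) auto
    finally show ?thesis by simp
  next
    case False
    then show ?thesis using rakotch_modulusD(5)[OF w(1) that] by simp
  qed
  then have "d (f x) (f y) \<le> max e (max 0 c * d x y)" if "x \<in> M" "y \<in> M" for x y
    using w(2)[OF that] nonneg by (meson order_trans)
  then show ?thesis using c(1) by (intro that[of "max 0 c"]) auto
qed

lemma (in Metric_space) rakotch_system_le_max:
  assumes "finite G" and "\<forall>g\<in>G. rakotch_contraction M d M d g" and "e > 0"
  shows "\<exists>c. 0 \<le> c \<and> c < 1 \<and> (\<forall>g\<in>G. \<forall>x\<in>M. \<forall>y\<in>M. d (g x) (g y) \<le> max e (c * d x y))"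
  using assms(1,2)
proof (induction G)
  case empty
  show ?case by (intro exI[of _ 0]) simp
next
  case (insert g G)
  then obtain c where c: "0 \<le> c" "c < 1" "\<forall>g\<in>G. \<forall>x\<in>M. \<forall>y\<in>M. d (g x) (g y) \<le> max e (c * d x y)"
    by auto
  obtain b where b: "0 \<le> b" "b < 1" "\<And>x y. x \<in> M \<Longrightarrow> y \<in> M \<Longrightarrow> d (g x) (g y) \<le> max e (b * d x y)"
    using rakotch_contraction_le_max[OF _ \<open>e > 0\<close>, of g] insert.prems by auto
  have mono: "max e (b * d x y) \<le> max e (max b c * d x y)"
    "max e (c * d x y) \<le> max e (max b c * d x y)" for x y
    by (intro max.mono mult_right_mono; simp)+
  show ?case
  proof (intro exI[of _ "max b c"] conjI ballI)
    fix h x y assume "h \<in> insert g G" "x \<in> M" "y \<in> M"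
    then show "d (h x) (h y) \<le> max e (max b c * d x y)"
      using b(3)[of x y] c(3) mono[of x y] by (metis insertE order_trans)
  qed (use b c in auto)
qed

text \<open>\<open>SUP\<close> and \<open>INF\<close> over the reals are informative only for
  nonempty bounded families. The bounds come from 0 and from \<open>r\<close>, which is why
  nonnegativity is proved under the same hypotheses.\<close>

lemma (in Metric_space) hausdorff_dist_le:
  assumes "A \<noteq> {}" "B \<noteq> {}"
    and AB: "\<And>x. x \<in> A \<Longrightarrow> \<exists>y\<in>B. d x y \<le> r" and BA: "\<And>y. y \<in> B \<Longrightarrow> \<exists>x\<in>A. d x y \<le> r"
  shows "0 \<le> hausdorff_dist d A B" "hausdorff_dist d A B \<le> r"
proof -
  have bdd: "bdd_below (d x ` B)" "bdd_below ((\<lambda>x. d x y) ` A)" for x y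
    by (auto intro!: bdd_belowI2[of _ 0])
  have 1: "(INF y\<in>B. d x y) \<le> r" if "x \<in> A" for x
    using AB[OF that] cINF_lower2[OF bdd(1)] by blast
  have 2: "(INF x\<in>A. d x y) \<le> r" if "y \<in> B" for y
    using BA[OF that] cINF_lower2[OF bdd(2)] by blast
  show "hausdorff_dist d A B \<le> r"
    unfolding hausdorff_dist_def using assms(1,2) 1 2 by (auto intro!: cSUP_least)
  obtain x where x: "x \<in> A" using assms(1) by blast
  have "0 \<le> (INF y\<in>B. d x y)" using assms(2) by (intro cINF_greatest) auto
  also have "\<dots> \<le> (SUP x\<in>A. INF y\<in>B. d x y)"
    using x 1 by (intro cSUP_upper bdd_aboveI2[of _ _ r])
  finally show "0 \<le> hausdorff_dist d A B" unfolding hausdorff_dist_def by simp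
qed

text \<open>Both \<open>A\<close> and the next iterate of \<open>K\<close> are unions of images
  under the same maps, so applying one \<open>g\<close> to a pair of close points, one from each
  set, gives a close pair at the next stage. Up to the scale e/2 the distance shrinks
  geometrically.\<close>

lemma (in Metric_space) rakotch_system_attractor:
  assumes "finite G" and G: "\<forall>g\<in>G. rakotch_contraction M d M d g"
    and A: "A \<noteq> {}" "compactin mtopology A" "fs_image G A = A"
  shows "attractor M d G A"
  unfolding attractor_def
proof (intro conjI allI impI A)
  fix K assume K: "K \<noteq> {} \<and> compactin mtopology K"
  have GM: "g x \<in> M" if "g \<in> G" "x \<in> M" for g x
    using G that unfolding rakotch_contraction_def by blast
  \<comment> \<open>A nonempty invariant set excludes the empty system, under which the iterates of
    \<open>K\<close> would become empty.\<close>
  have "G \<noteq> {}" using A(1,3) unfolding fs_image_def by auto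
  have AM: "A \<subseteq> M" using A(2) compactin_subset_topspace by fastforce
  define I where "I n = (fs_image G ^^ n) K" for n
  have I: "I n \<noteq> {} \<and> I n \<subseteq> M" for n
  proof (induction n)
    case 0
    then show ?case using K compactin_subset_topspace by (fastforce simp: I_def)
  next
    case (Suc n)
    then show ?case using \<open>G \<noteq> {}\<close> GM by (auto simp: I_def fs_image_def)
  qed
  have "mbounded (K \<union> A)"
    using K A(2) by (intro compactin_imp_mbounded compactin_Un) auto
  then obtain R where R: "\<forall>x\<in>K \<union> A. \<forall>y\<in>K \<union> A. d x y \<le> R"
    unfolding mbounded_alt by blast
  show "(\<lambda>n. hausdorff_dist d ((fs_image G ^^ n) K) A) \<longlonglongrightarrow> 0"
  proof (rule LIMSEQ_I)
    fix e :: real assume "e > 0"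
    then obtain c where c: "0 \<le> c" "c < 1"
        "\<forall>g\<in>G. \<forall>x\<in>M. \<forall>y\<in>M. d (g x) (g y) \<le> max (e/2) (c * d x y)"
      using rakotch_system_le_max[OF assms(1) G, of "e/2"] by auto
    \<comment> \<open>\<open>R\<close> bounds the distances at the start, and the floor e/2 absorbs
      the scale at which no contraction constant is available; eventually r n < e.\<close>
    define r where "r n = max (e/2) (c ^ n * R)" for n
    have step: "d (g x) (g y) \<le> r (Suc n)" if "g \<in> G" "x \<in> M" "y \<in> M" "d x y \<le> r n" for g x y n
    proof -
      have "c * d x y \<le> c * r n" using that c(1) by (intro mult_left_mono) auto
      also have "\<dots> = max (c * (e/2)) (c ^ Suc n * R)"
        using c(1) by (simp add: r_def max_mult_distrib_left mult.assoc)
      also have "\<dots> \<le> r (Suc n)"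
        unfolding r_def using c \<open>e > 0\<close> mult_right_mono[of c 1 "e/2"] by (intro max.mono) auto
      finally show ?thesis using c(3) that by (fastforce simp: r_def)
    qed
    have near: "(\<forall>p\<in>I n. \<exists>q\<in>A. d p q \<le> r n) \<and> (\<forall>q\<in>A. \<exists>p\<in>I n. d p q \<le> r n)" for n
    proof (induction n)
      case 0
      have le: "d p q \<le> r 0" if "p \<in> K" "q \<in> A" for p q
        using R that by (simp add: r_def max.coboundedI2)
      obtain k a where "k \<in> K" "a \<in> A" using K A(1) by blast
      then show ?case unfolding I_def using le by auto
    next
      case (Suc n)
      have "\<exists>q\<in>A. d p q \<le> r (Suc n)" if "p \<in> I (Suc n)" for p
      proof -
        obtain g x where gx: "g \<in> G" "x \<in> I n" "p = g x"
          using \<open>p \<in> I (Suc n)\<close> by (auto simp: I_def fs_image_def)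
        then obtain y where y: "y \<in> A" "d x y \<le> r n" using Suc by blast
        then have "g y \<in> A" using A(3) gx unfolding fs_image_def by blast
        then show ?thesis using step[of g x y n] gx y I[of n] AM by blast
      qed
      moreover have "\<exists>p\<in>I (Suc n). d p q \<le> r (Suc n)" if "q \<in> A" for q
      proof -
        obtain g y where gy: "g \<in> G" "y \<in> A" "q = g y"
          using \<open>q \<in> A\<close> A(3) unfolding fs_image_def by blast
        then obtain x where x: "x \<in> I n" "d x y \<le> r n" using Suc by blast
        then have "g x \<in> I (Suc n)" using gy by (auto simp: I_def fs_image_def)
        then show ?thesis using step[of g x y n] gy x I[of n] AM by blast
      qed
      ultimately show ?case by blast
    qed
    have "(\<lambda>n. c ^ n * R) \<longlonglongrightarrow> 0"
      using c by (intro tendsto_mult_left_zero LIMSEQ_power_zero) auto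
    then have "\<forall>\<^sub>F n in sequentially. c ^ n * R < e"
      using \<open>e > 0\<close> by (rule order_tendstoD(2))
    then obtain N where N: "\<forall>n\<ge>N. c ^ n * R < e"
      unfolding eventually_sequentially by metis
    have small: "norm (hausdorff_dist d (I n) A - 0) < e" if "n \<ge> N" for n
    proof -
      have "0 \<le> hausdorff_dist d (I n) A" "hausdorff_dist d (I n) A \<le> r n"
        using hausdorff_dist_le[of "I n" A "r n"] I[of n] A(1) near[of n] by auto
      moreover have "r n < e" using N that \<open>e > 0\<close> by (simp add: r_def)
      ultimately show ?thesis by simp
    qed
    show "\<exists>N. \<forall>n\<ge>N. norm (hausdorff_dist d ((fs_image G ^^ n) K) A - 0) < e"
      using small[unfolded I_def] by (intro exI[of _ N] allI impI)
  qed
qed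

section \<open>Fractals as attractors in the Urysohn space\<close>

text \<open>A negative constant can be raised to 0; nonnegativity is what makes multiplication by
  \<open>L\<close> a Rakotch modulus.\<close>

lemma banach_contraction_iff_nonneg:
  assumes "Metric_space X dX"
  shows "banach_contraction X dX Y dY f \<longleftrightarrow>
    f ` X \<subseteq> Y \<and> (\<exists>L. 0 \<le> L \<and> L < 1 \<and> (\<forall>x\<in>X. \<forall>x'\<in>X. dY (f x) (f x') \<le> L * dX x x'))"
proof -
  interpret Metric_space X dX by fact
  have "L * dX x y \<le> max 0 L * dX x y" for L x y by (intro mult_right_mono) auto
  then have "\<forall>x\<in>X. \<forall>x'\<in>X. dY (f x) (f x') \<le> max 0 L * dX x x'"
    if "\<forall>x\<in>X. \<forall>x'\<in>X. dY (f x) (f x') \<le> L * dX x x'" for L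
    using that by (meson order_trans)
  then have "(\<exists>L<1. \<forall>x\<in>X. \<forall>x'\<in>X. dY (f x) (f x') \<le> L * dX x x') \<longleftrightarrow>
      (\<exists>L. 0 \<le> L \<and> L < 1 \<and> (\<forall>x\<in>X. \<forall>x'\<in>X. dY (f x) (f x') \<le> L * dX x x'))"
    by (metis max.cobounded1 max_less_iff_conj zero_less_one)
  then show ?thesis unfolding banach_contraction_def by simp
qed

lemma (in Metric_space) compact_imp_separable_space:
  assumes "compact_space mtopology"
  shows "separable_space mtopology"
proof -
  have "mtotally_bounded M"
    using assms compactin_imp_mtotally_bounded unfolding compact_space_def by simp
  then have "\<forall>n. \<exists>K. finite K \<and> K \<subseteq> M \<and> M \<subseteq> (\<Union>x\<in>K. mball x (inverse (real (Suc n))))"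
    unfolding mtotally_bounded_def by (metis inverse_positive_iff_positive of_nat_0_less_iff zero_less_Suc)
  then obtain N where N: "\<And>n. finite (N n)" "\<And>n. N n \<subseteq> M"
      "\<And>n. M \<subseteq> (\<Union>x\<in>N n. mball x (inverse (real (Suc n))))"
    by metis
  have "\<exists>y\<in>\<Union>(range N). y \<in> mball x r" if x: "x \<in> M" and "r > 0" for x r
  proof -
    obtain n where n: "inverse (real (Suc n)) < r" using reals_Archimedean[OF \<open>r > 0\<close>] by auto
    obtain y where y: "y \<in> N n" "x \<in> mball y (inverse (real (Suc n)))" using N(3)[of n] x by blast
    then have "y \<in> mball x r" using n commute[of x y] by simp
    with y show ?thesis by blast
  qed
  then have "mtopology closure_of \<Union>(range N) = M"
    unfolding metric_closure_of by blast
  moreover have "countable (\<Union>(range N))" using N(1) by (simp add: countable_finite)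
  moreover have "\<Union>(range N) \<subseteq> M" using N(2) by blast
  ultimately show ?thesis unfolding separable_space_def by auto
qed

context Urysohn
begin

text \<open>The moduli are parameters and reappear in the last conclusion, so that one construction
  serves both kinds of fractals: linear moduli return Lipschitz bounds on \<open>U\<close>.\<close>

lemma compact_fractal_realized:
  assumes X: "Metric_space X dX" "X \<noteq> {}" "compact_space (Metric_space.mtopology X dX)"
    and F: "finite F" "X = fs_image F X"
    and w: "\<And>f. f \<in> F \<Longrightarrow> rakotch_modulus (w f)"
    and Fw: "\<And>f x y. f \<in> F \<Longrightarrow> x \<in> X \<Longrightarrow> y \<in> X \<Longrightarrow> dX (f x) (f y) \<le> w f (dX x y)"
  obtains G A where "function_system U d G" "\<forall>g\<in>G. rakotch_contraction U d U d g"
    "attractor U d G A" "isometric X dX A d"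
    "\<And>g. g \<in> G \<Longrightarrow> \<exists>f\<in>F. \<forall>x\<in>U. \<forall>y\<in>U. d (g x) (g y) \<le> w f (d x y)"
proof -
  interpret X: Metric_space X dX by fact
  have "separable_space X.mtopology"
    using X(3) by (rule X.compact_imp_separable_space)
  then obtain e where "isometric_embedding X dX U d e"
    using separable_embeds X(1) by blast
  then have eU: "e ` X \<subseteq> U" and e: "\<And>x y. x \<in> X \<Longrightarrow> y \<in> X \<Longrightarrow> d (e x) (e y) = dX x y"
    unfolding isometric_embedding_def by auto
  define A where "A = e ` X"
  have "continuous_map X.mtopology mtopology e"
    unfolding X.metric_continuous_map[OF Metric_space_axioms] using eU e by auto
  then have compA: "compactin mtopology A"
    using X(3) image_compactin unfolding A_def compact_space_def by fastforce
  have inj: "inj_on e X"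
    using e X.zero by (intro inj_onI) metis
  have FX: "f x \<in> X" if "f \<in> F" "x \<in> X" for f x
    using F(2) that unfolding fs_image_def by blast
  have "\<exists>g. g ` U \<subseteq> U \<and> (\<forall>x\<in>X. g (e x) = e (f x)) \<and>
      (\<forall>x\<in>U. \<forall>y\<in>U. d (g x) (g y) \<le> w f (d x y))" if f: "f \<in> F" for f
  proof -
    \<comment> \<open>The map \<open>f\<close> transported to the isometric copy
      \<open>A\<close>.\<close>
    let ?f = "\<lambda>a. e (f (inv_into X e a))"
    have fe: "?f (e x) = e (f x)" if "x \<in> X" for x using inj that by simp
    have tb: "mtotally_bounded A" using compA by (rule compactin_imp_mtotally_bounded)
    have ne: "A \<noteq> {}" using X(2) by (simp add: A_def)
    have im: "?f ` A \<subseteq> U" using fe FX[OF f] eU by (auto simp: A_def)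
    have le: "d (?f a) (?f b) \<le> w f (d a b)" if "a \<in> A" "b \<in> A" for a b
      using that fe FX[OF f] Fw[OF f] e by (auto simp: A_def)
    obtain g where "g ` U \<subseteq> U" "\<And>a. a \<in> A \<Longrightarrow> g a = ?f a"
        "\<And>x y. x \<in> U \<Longrightarrow> y \<in> U \<Longrightarrow> d (g x) (g y) \<le> w f (d x y)"
      by (rule contractive_extension[OF w[OF f] tb ne im], erule (1) le) (rule that)
    then show ?thesis using fe by (intro exI[of _ g]) (auto simp: A_def)
  qed
  then obtain E where E: "\<And>f. f \<in> F \<Longrightarrow> E f ` U \<subseteq> U"
    "\<And>f x. f \<in> F \<Longrightarrow> x \<in> X \<Longrightarrow> E f (e x) = e (f x)"
    "\<And>f x y. f \<in> F \<Longrightarrow> x \<in> U \<Longrightarrow> y \<in> U \<Longrightarrow> d (E f x) (E f y) \<le> w f (d x y)"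
    by metis
  have rak: "rakotch_contraction U d U d (E f)" if "f \<in> F" for f
    unfolding rakotch_contraction_def
    using E(1)[OF that] E(3)[OF that] w[OF that]
    by (intro conjI exI[of _ "w f"]) (simp_all add: rakotch_modulus_def)
  have "fs_image (E ` F) A = e ` fs_image F X"
    unfolding fs_image_def A_def by (simp add: image_UN image_image E(2))
  with F(2) have inv: "fs_image (E ` F) A = A" by (simp add: A_def)
  show ?thesis
  proof
    show "\<forall>g\<in>E ` F. rakotch_contraction U d U d g" using rak by blast
    then show "function_system U d (E ` F)" "attractor U d (E ` F) A"
      using F(1) rakotch_contraction_imp_continuous rakotch_system_attractor[of "E ` F" A] compA inv X(2)
      unfolding function_system_def by (auto simp: A_def)
    show "isometric X dX A d"
      unfolding isometric_def isometric_embedding_def using e by (auto simp: A_def)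
    show "\<exists>f\<in>F. \<forall>x\<in>U. \<forall>y\<in>U. d (g x) (g y) \<le> w f (d x y)" if "g \<in> E ` F" for g
      using that E(3) by blast
  qed
qed

end

theorem theorem1p4:
  fixes U :: "'b set" and dU :: "'b \<Rightarrow> 'b \<Rightarrow> real"
    and X :: "'a set" and dX :: "'a \<Rightarrow> 'a \<Rightarrow> real"
  assumes "urysohn_space U dU"
    and "Metric_space X dX"
    and "X \<noteq> {}"
    and "compact_space (Metric_space.mtopology X dX)"
  shows "(rakotch_fractal X dX \<longrightarrow>
           (\<exists>G A. function_system U dU G \<and> (\<forall>g\<in>G. rakotch_contraction U dU U dU g) \<and>
                  attractor U dU G A \<and> isometric X dX A dU))
       \<and> (banach_fractal X dX \<longrightarrow>
           (\<exists>G A. function_system U dU G \<and> (\<forall>g\<in>G. banach_contraction U dU U dU g) \<and>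
                  attractor U dU G A \<and> isometric X dX A dU))"
proof -
  interpret U: Urysohn U dU
    using assms(1) by (simp add: Urysohn_def Urysohn_axioms_def urysohn_space_def)
  interpret X: Metric_space X dX by fact
  show ?thesis
  proof (intro conjI impI)
    assume "rakotch_fractal X dX"
    then obtain F where F: "finite F" "X = fs_image F X"
        and rak: "\<forall>f\<in>F. rakotch_contraction X dX X dX f"
      unfolding rakotch_fractal_def function_system_def by blast
    have "\<exists>w. rakotch_modulus w \<and> (\<forall>x\<in>X. \<forall>y\<in>X. dX (f x) (f y) \<le> w (dX x y))" if "f \<in> F" for f
      using rakotch_contraction_modulus[of X dX X dX f] rak that assms(2) by metis
    then obtain w where w: "\<And>f. f \<in> F \<Longrightarrow> rakotch_modulus (w f)"
      "\<And>f x y. f \<in> F \<Longrightarrow> x \<in> X \<Longrightarrow> y \<in> X \<Longrightarrow> dX (f x) (f y) \<le> w f (dX x y)"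
      by metis
    show "\<exists>G A. function_system U dU G \<and> (\<forall>g\<in>G. rakotch_contraction U dU U dU g) \<and>
        attractor U dU G A \<and> isometric X dX A dU"
      by (rule U.compact_fractal_realized[OF assms(2-4) F], erule w(1), erule (2) w(2)) blast
  next
    assume "banach_fractal X dX"
    then obtain F where F: "finite F" "X = fs_image F X"
        and ban: "\<forall>f\<in>F. banach_contraction X dX X dX f"
      unfolding banach_fractal_def function_system_def by blast
    then obtain L where L: "\<And>f. f \<in> F \<Longrightarrow> 0 \<le> L f" "\<And>f. f \<in> F \<Longrightarrow> L f < 1"
      "\<And>f x y. f \<in> F \<Longrightarrow> x \<in> X \<Longrightarrow> y \<in> X \<Longrightarrow> dX (f x) (f y) \<le> L f * dX x y"
      unfolding banach_contraction_iff_nonneg[OF assms(2)] by metis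
    \<comment> \<open>Each g inherits the Lipschitz constant of some f through the linear modulus,
      so it is again a Banach contraction.\<close>
    obtain G A where G: "function_system U dU G" "\<forall>g\<in>G. rakotch_contraction U dU U dU g"
      "attractor U dU G A" "isometric X dX A dU"
      "\<And>g. g \<in> G \<Longrightarrow> \<exists>f\<in>F. \<forall>x\<in>U. \<forall>y\<in>U. dU (g x) (g y) \<le> L f * dU x y"
      by (rule U.compact_fractal_realized[OF assms(2-4) F, of "\<lambda>f t. L f * t"],
          rule linear_rakotch_modulus, erule L(1), erule L(2), erule (2) L(3)) (rule that)
    have "banach_contraction U dU U dU g" if "g \<in> G" for g
      using G(2) G(5)[OF that] L(2) that unfolding banach_contraction_def rakotch_contraction_def by blast
    with G show "\<exists>G A. function_system U dU G \<and> (\<forall>g\<in>G. banach_contraction U dU U dU g) \<and>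
        attractor U dU G A \<and> isometric X dX A dU"
      by blast
  qed
qed

end
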